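(* Let $n>1$. Let $J^\alpha f=K_\alpha\ast f$ be a family of operators defined by convolution, where $K_\alpha,f:(0,\infty)^n\rightarrow\mathbb{R}$, $\alpha\in(0,\infty)^n$, $f\in\mathcal{L}$, and $K_\alpha\in\mathcal{L}$ for all $\alpha\in(0,\infty)^n$. Suppose: - Identity: for all $i\in\{1,\ldots,n\}$, $\widehat{K}_\alpha(x)\rightarrow 1/x_i$ on $(0,\infty)^n$ (i.e. for every $x\in(0,\infty)^n$) when $\alpha_j\rightarrow 0$ for $j\neq i$ and $\alpha_i=1$; - Index law: $J^{\alpha+\beta}=J^\alpha\circ J^\beta$ on $\mathcal{L}$ for all $\alpha,\beta\in(0,\infty)^n$; - Continuity: for all $x\in(0,\infty)^n$, the map $\alpha\mapsto\widehat{K}_\alpha(x)$ from $(0,\infty)^n$ to $\mathbb{R}$ is continuous at one point. (This condition is equivalent to: for all $f\in\mathcal{L}$ and $x\in(0,\infty)^n$, the map $\alpha\mapsto\widehat{J^\alpha f}(x)$ from $(0,\infty)^n$ to $\mathbb{R}$ is continuous at one point.) Then $J^\alpha=I^\alpha$ is the multidimensional Riemann-Liouville integral on $\mathcal{L}$, for all $\alpha\in(0,\infty)^n$.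
   Context: $\mathcal{L}$ is the set of Laplace transformable functions $f:(0,\infty)^n\to\mathbb{R}$, i.e. those for which $\widehat{f}(x):=\int_{(0,\infty)^n}f(s)\mathrm{e}^{-s\cdot x}\,\mathrm{d}s$ is well-defined (as a Lebesgue integral) for all $x\in(0,\infty)^n$; in particular $f\in\mathrm{L}^1(0,T)$ for every box $(0,T)=(0,T_1)\times\cdots\times(0,T_n)$ with $T\in(0,\infty)^n$. The hat denotes this Laplace transform. Convolution is $(K\ast f)(t)=\int_{[0,t_1]\times\cdots\times[0,t_n]}K(t-s)f(s)\,\mathrm{d}s$. For $\alpha\in(0,\infty)^n$, $I^\alpha f=g_\alpha\ast f$ with $g_\alpha(t)=\prod_{i=1}^nt_i^{\alpha_i-1}/\Gamma(\alpha_i)$ is the Riemann-Liouville integral with left origin $(0,\ldots,0)$. Functions are identified when equal almost everywhere. *)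

theory Defs
  imports "HOL-Analysis.Analysis"
begin

definition orthant :: "(real ^ 'n) set" where
  "orthant = {x. \<forall>i. 0 < x $ i}"

text \<open>Functions on the orthant are represented by total functions; their values elsewhere
  are irrelevant. Note that \<^const>\<open>absolutely_integrable_on\<close> is integrability with
  respect to the Lebesgue measure and includes measurability on the set.\<close>

definition laplace_transformable :: "(real ^ 'n \<Rightarrow> real) set" where
  "laplace_transformable =
     {f. \<forall>x\<in>orthant. (\<lambda>s. f s * exp (- (s \<bullet> x))) absolutely_integrable_on orthant}"

definition laplace :: "(real ^ 'n \<Rightarrow> real) \<Rightarrow> real ^ 'n \<Rightarrow> real" where
  "laplace f x = (LINT s:orthant|lebesgue. f s * exp (- (s \<bullet> x)))"

text \<open>For \<open>t\<close> in the orthant, \<open>cbox 0 t\<close> is the product of the intervals from \<open>0\<close> to \<open>t $ i\<close>.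
  The integrand is evaluated outside the orthant only on the null set of those \<open>s\<close> with
  \<open>s $ i = 0\<close> or \<open>s $ i = t $ i\<close> for some \<open>i\<close>. For Laplace transformable functions the integral
  exists for almost every \<open>t\<close>; elsewhere it is \<open>0\<close> by convention, so operators built from
  it are only to be compared almost everywhere.\<close>

definition convolution :: "(real ^ 'n \<Rightarrow> real) \<Rightarrow> (real ^ 'n \<Rightarrow> real) \<Rightarrow> real ^ 'n \<Rightarrow> real" where
  "convolution K f t = (LINT s:cbox 0 t|lebesgue. K (t - s) * f s)"

definition riemann_liouville_kernel :: "real ^ 'n \<Rightarrow> real ^ 'n \<Rightarrow> real" where
  "riemann_liouville_kernel \<alpha> t = (\<Prod>i\<in>UNIV. t $ i powr (\<alpha> $ i - 1) / Gamma (\<alpha> $ i))"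

definition riemann_liouville :: "real ^ 'n \<Rightarrow> (real ^ 'n \<Rightarrow> real) \<Rightarrow> real ^ 'n \<Rightarrow> real" where
  "riemann_liouville \<alpha> f = convolution (riemann_liouville_kernel \<alpha>) f"

text \<open>The limit is a joint one: \<open>\<alpha>\<close> tends to the \<open>i\<close>-th unit vector inside the part of the
  orthant where \<open>\<alpha> $ i = 1\<close>. That vector is not itself in the orthant if the dimension
  exceeds 1.\<close>

definition identity_condition :: "(real ^ 'n \<Rightarrow> real ^ 'n \<Rightarrow> real) \<Rightarrow> bool" where
  "identity_condition K \<longleftrightarrow>
     (\<forall>i. \<forall>x\<in>orthant.
        ((\<lambda>\<alpha>. laplace (K \<alpha>) x) \<longlongrightarrow> 1 / x $ i) (at (axis i 1) within {\<alpha>\<in>orthant. \<alpha> $ i = 1}))"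

definition index_law ::
    "(real ^ 'n \<Rightarrow> (real ^ 'n \<Rightarrow> real) \<Rightarrow> real ^ 'n \<Rightarrow> real) \<Rightarrow> bool" where
  "index_law J \<longleftrightarrow>
     (\<forall>\<alpha>\<in>orthant. \<forall>\<beta>\<in>orthant. \<forall>f\<in>laplace_transformable.
        AE t\<in>orthant in lebesgue. J (\<alpha> + \<beta>) f t = (J \<alpha> \<circ> J \<beta>) f t)"

text \<open>In both continuity conditions the point of continuity may depend on the
  universally quantified data.\<close>

definition kernel_continuity :: "(real ^ 'n \<Rightarrow> real ^ 'n \<Rightarrow> real) \<Rightarrow> bool" where
  "kernel_continuity K \<longleftrightarrow>
     (\<forall>x\<in>orthant. \<exists>\<alpha>\<^sub>0\<in>orthant.
        continuous (at \<alpha>\<^sub>0 within orthant) (\<lambda>\<alpha>. laplace (K \<alpha>) x))"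

definition operator_continuity ::
    "(real ^ 'n \<Rightarrow> (real ^ 'n \<Rightarrow> real) \<Rightarrow> real ^ 'n \<Rightarrow> real) \<Rightarrow> bool" where
  "operator_continuity J \<longleftrightarrow>
     (\<forall>f\<in>laplace_transformable. \<forall>x\<in>orthant. \<exists>\<alpha>\<^sub>0\<in>orthant.
        continuous (at \<alpha>\<^sub>0 within orthant) (\<lambda>\<alpha>. laplace (J \<alpha> f) x))"

end

theory Submission
  imports Defs
begin

text \<open>The Laplace transform turns convolution into multiplication, so by the index law
  \<open>\<alpha> \<mapsto> laplace (K \<alpha>) x\<close> is multiplicative on the orthant for each fixed \<open>x\<close>. A zero would propagate
  to the whole orthant by halving and contradict the identity condition; hence this function is
  positive, its logarithm is additive and continuous at a point, thus linear, and the identity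
  condition determines the coefficients as \<open>- ln (x $ i)\<close>. Therefore \<open>K \<alpha>\<close> and the Riemann-Liouville
  kernel have the same Laplace transform. They agree almost everywhere because the Laplace
  transform is injective: after the substitution \<open>y = exp (- s)\<close> this follows from the
  Stone-Weierstrass theorem.\<close>

section \<open>The convolution theorem\<close>

text \<open>With the indicator inside the integrand, transforms become integrals over the whole
  space, and convolution over boxes becomes ordinary convolution there.\<close>

definition laplace_integrand :: "(real ^ 'n \<Rightarrow> real) \<Rightarrow> real ^ 'n \<Rightarrow> real ^ 'n \<Rightarrow> real" where
  "laplace_integrand f x s = indicator orthant s * (f s * exp (- (s \<bullet> x)))"

lemma laplace_transformable_iff:
  "f \<in> laplace_transformable \<longleftrightarrow> (\<forall>x\<in>orthant. integrable lebesgue (laplace_integrand f x))"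
  by (simp add: laplace_transformable_def set_integrable_def laplace_integrand_def[abs_def])

lemma laplace_eq_integral: "laplace f x = integral\<^sup>L lebesgue (laplace_integrand f x)"
  by (simp add: laplace_def set_lebesgue_integral_def laplace_integrand_def[abs_def])

lemma open_orthant: "open (orthant :: (real ^ 'n) set)"
proof -
  have "open (\<Inter>i. {x :: real ^ 'n. 0 < x $ i})"
    by (intro open_INT ballI finite open_Collect_less continuous_intros)
  also have "(\<Inter>i. {x :: real ^ 'n. 0 < x $ i}) = orthant"
    by (auto simp: orthant_def)
  finally show ?thesis .
qed

text \<open>The map \<open>s -> t - s\<close> preserves Lebesgue measure, so it pulls null sets back
  to null sets.\<close>

lemma AE_lborel_reflect:
  fixes t :: "'a :: euclidean_space"
  assumes "AE s in lborel. P s"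
  shows "AE s in lborel. P (t - s)"
proof -
  have eq: "lborel = distr lborel borel (\<lambda>s. t - s)"
    using lborel_affine[of "-1" t] by (simp add: density_1)
  \<comment> \<open>The exceptional set of \<open>P\<close> need not be measurable; its null
    superset \<open>N\<close> can be pulled back.\<close>
  obtain N where N: "N \<in> null_sets lborel" "{s. \<not> P s} \<subseteq> N"
    using assms unfolding eventually_ae_filter by auto
  have "AE s in distr lborel borel (\<lambda>s. t - s). s \<notin> N"
    using AE_not_in[OF N(1)] eq by metis
  then have "AE s in lborel. t - s \<notin> N"
    using N(1) by (subst (asm) AE_distr_iff) (auto dest: null_setsD2)
  then show ?thesis
    by eventually_elim (use N in auto)
qed

text \<open>Fubini: for fixed \<open>s\<close>, integrating over \<open>t\<close> first gives
  \<open>G s\<close> times the integral of \<open>F\<close>, by translation invariance.\<close>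

lemma convolution_lborel:
  fixes F G :: "'a :: euclidean_space \<Rightarrow> real"
  assumes F: "integrable lborel F" and G: "integrable lborel G"
  shows "integrable lborel (\<lambda>t. \<integral>s. F (t - s) * G s \<partial>lborel)"
    and "(\<integral>t. (\<integral>s. F (t - s) * G s \<partial>lborel) \<partial>lborel) = (\<integral>s. F s \<partial>lborel) * (\<integral>s. G s \<partial>lborel)"
proof -
  have [measurable]: "F \<in> borel_measurable borel" "G \<in> borel_measurable borel"
    using F G by auto
  have shift: "integrable lborel (\<lambda>t. H (t - s)) \<and> (\<integral>t. H (t - s) \<partial>lborel) = (\<integral>t. H t \<partial>lborel)"
    if "integrable lborel H" for H :: "'a \<Rightarrow> real" and s
  proof -
    have [measurable]: "H \<in> borel_measurable borel" using that by auto
    have "integrable (distr lborel borel ((+) (- s))) H"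
      using that lborel_distr_plus[of "- s"] by simp
    then have "integrable lborel (\<lambda>t. H (t - s))"
      by (subst (asm) integrable_distr_eq) auto
    moreover have "(\<integral>t. H t \<partial>distr lborel borel ((+) (- s))) = (\<integral>t. H (- s + t) \<partial>lborel)"
      by (rule integral_distr) auto
    then have "(\<integral>t. H (t - s) \<partial>lborel) = (\<integral>t. H t \<partial>lborel)"
      using lborel_distr_plus[of "- s"] by simp
    ultimately show ?thesis by blast
  qed
  have int: "integrable (lborel \<Otimes>\<^sub>M lborel) (\<lambda>(s, t). F (t - s) * G s)"
  proof (rule lborel_pair.Fubini_integrable)
    show "integrable lborel (\<lambda>s. \<integral>t. norm (case (s, t) of (s, t) \<Rightarrow> F (t - s) * G s) \<partial>lborel)"
      using shift[of "\<lambda>t. norm (F t)"] F G by (simp add: abs_mult)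
    show "AE s in lborel. integrable lborel (\<lambda>t. case (s, t) of (s, t) \<Rightarrow> F (t - s) * G s)"
      using shift[of F] F by simp
  qed measurable
  show "integrable lborel (\<lambda>t. \<integral>s. F (t - s) * G s \<partial>lborel)"
    using lborel_pair.integrable_snd[OF int] .
  show "(\<integral>t. (\<integral>s. F (t - s) * G s \<partial>lborel) \<partial>lborel) = (\<integral>s. F s \<partial>lborel) * (\<integral>s. G s \<partial>lborel)"
    using lborel_pair.Fubini_integral[OF int] shift[of F] F by simp
qed

text \<open>Fubini's theorem is applied on \<open>lborel\<close>, so Lebesgue integrable functions
  are first replaced by Borel ones.\<close>

lemma integrable_lebesgue_borel_version:
  fixes F :: "'a :: euclidean_space \<Rightarrow> real"
  assumes "integrable lebesgue F"
  obtains F' where "integrable lborel F'" "AE s in lborel. F s = F' s"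
    "integral\<^sup>L lebesgue F = integral\<^sup>L lborel F'"
proof -
  obtain F' where F': "F' \<in> borel_measurable lborel" "AE s in lborel. F s = F' s"
    using completion_ex_borel_measurable_real[of F lborel] assms by auto
  have ae: "AE s in lebesgue. F s = F' s" using F'(2) by (rule AE_completion)
  have m: "F' \<in> borel_measurable lebesgue" using F'(1) by (rule measurable_completion)
  have "integrable lebesgue F'"
    using assms ae m by (subst integrable_cong_AE[symmetric]) auto
  moreover have "integral\<^sup>L lebesgue F = integral\<^sup>L lebesgue F'"
    using assms ae m by (intro integral_cong_AE) auto
  ultimately show ?thesis
    using F' that by (simp add: integrable_completion integral_completion)
qed

text \<open>Either both functions are measurable or both integrals have the junk value \<open>0\<close>.\<close>

lemma integral_lebesgue_cong_AE:
  fixes F G :: "'a :: euclidean_space \<Rightarrow> real"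
  assumes ae: "AE s in lborel. F s = G s"
  shows "integral\<^sup>L lebesgue F = integral\<^sup>L lebesgue G"
    and "integrable lebesgue F \<longleftrightarrow> integrable lebesgue G"
proof -
  have ae: "AE s in lebesgue. F s = G s" "AE s in lebesgue. G s = F s"
    using ae by (auto intro: AE_completion elim: eventually_mono)
  have "F \<in> borel_measurable lebesgue \<longleftrightarrow> G \<in> borel_measurable lebesgue"
    using borel_measurable_AE[OF _ ae(1)] borel_measurable_AE[OF _ ae(2)] by blast
  note m = this
  show int: "integrable lebesgue F \<longleftrightarrow> integrable lebesgue G"
    using m integrable_cong_AE[OF _ _ ae(1)] borel_measurable_integrable by blast
  show "integral\<^sup>L lebesgue F = integral\<^sup>L lebesgue G"
  proof (cases "integrable lebesgue F")
    case True
    then show ?thesis using m ae by (intro integral_cong_AE) auto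
  next
    case False
    then show ?thesis using int by (simp add: not_integrable_integral_eq)
  qed
qed

lemma convolution_lebesgue:
  fixes F G :: "'a :: euclidean_space \<Rightarrow> real"
  assumes F: "integrable lebesgue F" and G: "integrable lebesgue G"
  shows "integrable lebesgue (\<lambda>t. \<integral>s. F (t - s) * G s \<partial>lebesgue)"
    and "(\<integral>t. (\<integral>s. F (t - s) * G s \<partial>lebesgue) \<partial>lebesgue) =
      (\<integral>s. F s \<partial>lebesgue) * (\<integral>s. G s \<partial>lebesgue)"
proof -
  obtain F' where F': "integrable lborel F'" "AE s in lborel. F s = F' s"
    "integral\<^sup>L lebesgue F = integral\<^sup>L lborel F'"
    using F by (rule integrable_lebesgue_borel_version)
  obtain G' where G': "integrable lborel G'" "AE s in lborel. G s = G' s"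
    "integral\<^sup>L lebesgue G = integral\<^sup>L lborel G'"
    using G by (rule integrable_lebesgue_borel_version)
  have [measurable]: "F' \<in> borel_measurable borel" "G' \<in> borel_measurable borel"
    using F' G' by auto
  \<comment> \<open>Reflection preserves null sets, so the inner integrals agree for every
    \<open>t\<close>, not merely for almost every \<open>t\<close>.\<close>
  have "(\<integral>s. F (t - s) * G s \<partial>lebesgue) = (\<integral>s. F' (t - s) * G' s \<partial>lborel)" for t
  proof -
    have "AE s in lborel. F (t - s) * G s = F' (t - s) * G' s"
      using AE_lborel_reflect[OF F'(2), of t] G'(2) by eventually_elim simp
    then have "(\<integral>s. F (t - s) * G s \<partial>lebesgue) = (\<integral>s. F' (t - s) * G' s \<partial>lebesgue)"
      by (rule integral_lebesgue_cong_AE)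
    also have "\<dots> = (\<integral>s. F' (t - s) * G' s \<partial>lborel)"
      by (rule integral_completion) measurable
    finally show ?thesis .
  qed
  note eq = this
  note c = convolution_lborel[OF F'(1) G'(1)]
  have m: "(\<lambda>t. \<integral>s. F' (t - s) * G' s \<partial>lborel) \<in> borel_measurable lborel"
    using c(1) by auto
  show "integrable lebesgue (\<lambda>t. \<integral>s. F (t - s) * G s \<partial>lebesgue)"
    unfolding eq using c(1) m by (simp add: integrable_completion)
  show "(\<integral>t. (\<integral>s. F (t - s) * G s \<partial>lebesgue) \<partial>lebesgue) =
      (\<integral>s. F s \<partial>lebesgue) * (\<integral>s. G s \<partial>lebesgue)"
    unfolding eq F'(3) G'(3) using c(2) m by (simp add: integral_completion)
qed

lemma AE_coordinate_neq: "AE s :: real ^ 'n in lborel. \<forall>i. s $ i \<noteq> t $ i"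
proof -
  have "AE s :: real ^ 'n in lborel. s $ i \<noteq> t $ i" for i
  proof -
    have "{s :: real ^ 'n. s $ i = t $ i} = {s. axis i 1 \<bullet> s = t $ i}"
      by (auto simp: inner_axis')
    moreover have "negligible {s :: real ^ 'n. axis i 1 \<bullet> s = t $ i}"
      by (rule negligible_hyperplane) (auto simp: axis_eq_0_iff)
    ultimately have "negligible {s :: real ^ 'n. s $ i = t $ i}" by simp
    \<comment> \<open>Closedness makes the hyperplane a Borel set, so that negligibility puts it
      among the null sets of \<open>lborel\<close>.\<close>
    moreover have "closed {s :: real ^ 'n. s $ i = t $ i}"
      by (intro closed_Collect_eq continuous_intros)
    ultimately have "{s :: real ^ 'n. s $ i = t $ i} \<in> null_sets lborel"
      by (simp add: negligible_iff_null_sets null_sets_completion_iff)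
    from AE_not_in[OF this] show ?thesis by simp
  qed
  then show ?thesis by (simp add: AE_all_countable)
qed

text \<open>Up to the null set where \<open>s\<close> or \<open>t - s\<close> has a zero coordinate, \<open>s \<in> cbox 0 t\<close> says that
  \<open>s\<close> and \<open>t - s\<close> are both in the orthant, which forces \<open>t\<close> to be in it.\<close>

lemma AE_cbox_iff:
  fixes t :: "real ^ 'n"
  shows "AE s in lborel. s \<in> cbox 0 t \<longleftrightarrow> t - s \<in> orthant \<and> s \<in> orthant"
  using AE_coordinate_neq[of 0] AE_coordinate_neq[of t]
proof eventually_elim
  case (elim s)
  have "0 \<le> s $ i \<and> s $ i \<le> t $ i \<longleftrightarrow> 0 < t $ i - s $ i \<and> 0 < s $ i" for i
    using elim(1)[rule_format, of i] elim(2)[rule_format, of i] by auto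
  then show ?case by (auto simp: orthant_def mem_box_cart)
qed

text \<open>The factors \<open>exp (- ((t - s) \<bullet> x))\<close> and
  \<open>exp (- (s \<bullet> x))\<close> multiply to \<open>exp (- (t \<bullet> x))\<close>, which
  leaves the integral over \<open>s\<close>. By \<open>AE_cbox_iff\<close> the two orthant
  indicators amount to that of the box. Pulling the factor out is valid also where the integral has
  its default value 0.\<close>

lemma laplace_integrand_convolution:
  "laplace_integrand (convolution K f) x t =
     (\<integral>s. laplace_integrand K x (t - s) * laplace_integrand f x s \<partial>lebesgue)"
proof -
  have ae: "AE s in lborel. laplace_integrand K x (t - s) * laplace_integrand f x s =
      (indicator orthant t * exp (- (t \<bullet> x))) * (indicator (cbox 0 t) s * (K (t - s) * f s))"
    using AE_cbox_iff[of t]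
  proof eventually_elim
    case (elim s)
    have "t \<in> orthant" if "t - s \<in> orthant" "s \<in> orthant"
      using that by (force simp: orthant_def intro: less_trans)
    then show ?case using elim
      by (auto simp: laplace_integrand_def indicator_def inner_diff_left mult_exp_exp[symmetric]
          exp_add[symmetric] algebra_simps)
  qed
  have "(\<integral>s. laplace_integrand K x (t - s) * laplace_integrand f x s \<partial>lebesgue) =
     (indicator orthant t * exp (- (t \<bullet> x))) * (\<integral>s. indicator (cbox 0 t) s * (K (t - s) * f s) \<partial>lebesgue)"
    unfolding integral_lebesgue_cong_AE(1)[OF ae] by (rule integral_mult_right_zero)
  then show ?thesis
    by (simp add: laplace_integrand_def convolution_def set_lebesgue_integral_def)
qed

text \<open>Both claims are \<open>convolution_lebesgue\<close> for the two integrands. Closure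
  under convolution lets the product formula be iterated, as the composition in the index law
  requires.\<close>

lemma
  assumes "K \<in> laplace_transformable" "f \<in> laplace_transformable"
  shows convolution_laplace_transformable: "convolution K f \<in> laplace_transformable"
    and laplace_convolution: "x \<in> orthant \<Longrightarrow> laplace (convolution K f) x = laplace K x * laplace f x"
proof -
  have K: "integrable lebesgue (laplace_integrand K x)" and f: "integrable lebesgue (laplace_integrand f x)"
    if "x \<in> orthant" for x
    using assms that by (simp_all add: laplace_transformable_iff)
  show "convolution K f \<in> laplace_transformable"
    unfolding laplace_transformable_iff laplace_integrand_convolution[abs_def]
    using convolution_lebesgue(1)[OF K f] by blast
  show "laplace (convolution K f) x = laplace K x * laplace f x" if "x \<in> orthant"
    unfolding laplace_eq_integral laplace_integrand_convolution[abs_def]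
    using convolution_lebesgue(2)[OF K f] that by blast
qed

section \<open>Invariance under almost everywhere equality\<close>

lemma laplace_integrand_cong_AE:
  assumes "AE t\<in>orthant in lebesgue. f t = g t"
  shows "AE t in lborel. laplace_integrand f x t = laplace_integrand g x t"
  using assms unfolding AE_completion_iff
  by eventually_elim (auto simp: laplace_integrand_def indicator_def)

lemma laplace_cong_AE:
  assumes "AE t\<in>orthant in lebesgue. f t = g t"
  shows "laplace f x = laplace g x"
  unfolding laplace_eq_integral
  by (rule integral_lebesgue_cong_AE) (rule laplace_integrand_cong_AE[OF assms])

text \<open>For fixed \<open>t\<close>, the map \<open>s -> t - s\<close> preserves null sets and
  sends almost every point of the box into the orthant, so the integrands agree almost everywhere.
  Hence the equality holds at every \<open>t\<close>.\<close>

lemma convolution_cong_AE: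
  fixes K L :: "real ^ 'n \<Rightarrow> real"
  assumes "AE t\<in>orthant in lebesgue. K t = L t"
  shows "convolution K f t = convolution L f t"
  unfolding convolution_def set_lebesgue_integral_def
proof (rule integral_lebesgue_cong_AE)
  have "AE t in lborel. t \<in> orthant \<longrightarrow> K t = L t"
    using assms by (simp add: AE_completion_iff)
  from AE_lborel_reflect[OF this, of t] AE_cbox_iff[of t]
  show "AE s in lborel. indicator (cbox 0 t) s *\<^sub>R (K (t - s) * f s) =
      indicator (cbox 0 t) s *\<^sub>R (L (t - s) * f s)"
    by eventually_elim (auto simp: indicator_def)
qed

section \<open>Cauchy's functional equation on the orthant\<close>

text \<open>Additivity gives homogeneity for rational factors. Continuity spreads from 0 to every
  point by translation, and the density of the rationals then gives real factors.\<close>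

lemma additive_continuous_imp_linear:
  fixes A :: "'a :: real_normed_vector \<Rightarrow> 'b :: real_normed_vector"
  assumes add: "\<And>x y. A (x + y) = A x + A y" and cont: "isCont A 0"
  shows "linear A"
proof -
  interpret additive A by unfold_locales (rule add)
  have isCont: "isCont A x" for x
  proof -
    have "(\<lambda>h. A x + A h) \<midarrow>0\<rightarrow> A x + A 0"
      using cont by (intro tendsto_intros) (simp add: isCont_def)
    then show ?thesis by (simp add: isCont_iff add zero)
  qed
  have nat: "A (of_nat n *\<^sub>R v) = of_nat n *\<^sub>R A v" for n v
    by (induction n) (simp_all add: scaleR_add_left add zero)
  have int: "A (of_int k *\<^sub>R v) = of_int k *\<^sub>R A v" for k v
    by (cases k rule: int_cases2) (simp_all add: nat minus)
  \<comment> \<open>Phrased as a vanishing difference, because a continuous function that is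
    constant on the rationals is constant on their closure.\<close>
  have rat: "A (q *\<^sub>R v) - q *\<^sub>R A v = 0" if "q \<in> \<rat>" for q v
  proof -
    obtain k n where q: "q = of_int k / of_nat n" "n > 0"
      using \<open>q \<in> \<rat>\<close> by (metis Rats_cases' of_int_of_nat_eq zero_less_imp_eq_int of_nat_0_less_iff)
    have "of_nat n *\<^sub>R A (q *\<^sub>R v) = A ((of_nat n * q) *\<^sub>R v)"
      by (simp flip: nat)
    also have "\<dots> = of_nat n *\<^sub>R (q *\<^sub>R A v)"
      using q by (simp add: int)
    finally have "A (q *\<^sub>R v) = q *\<^sub>R A v"
      by (rule scaleR_left_imp_eq[rotated]) (use q(2) in simp)
    then show ?thesis by simp
  qed
  have "A (r *\<^sub>R v) - r *\<^sub>R A v = 0" for r v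
  proof (rule continuous_constant_on_closure[where S = "\<rat>" and f = "\<lambda>r. A (r *\<^sub>R v) - r *\<^sub>R A v"])
    have "continuous_on UNIV A" using isCont by (simp add: continuous_at_imp_continuous_on)
    then have "continuous_on (closure \<rat>) (\<lambda>r. A (r *\<^sub>R v))"
      by (rule continuous_on_compose2) (auto intro!: continuous_intros)
    then show "continuous_on (closure \<rat>) (\<lambda>r. A (r *\<^sub>R v) - r *\<^sub>R A v)"
      by (intro continuous_intros)
  qed (auto simp: rat Rats_closure_real)
  then show ?thesis by (intro linearI) (auto simp: add)
qed

lemma orthant_add: "\<alpha> \<in> orthant \<Longrightarrow> \<beta> \<in> orthant \<Longrightarrow> \<alpha> + \<beta> \<in> orthant"
  by (auto simp: orthant_def intro: add_pos_pos)

lemma orthant_scaleR: "\<alpha> \<in> orthant \<Longrightarrow> 0 < c \<Longrightarrow> c *\<^sub>R \<alpha> \<in> orthant"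
  by (auto simp: orthant_def)

lemma vec_in_orthant: "0 < c \<Longrightarrow> vec c \<in> orthant"
  by (auto simp: orthant_def)

text \<open>Every vector is a difference of two vectors of the orthant, here \<open>v + p v\<close> and \<open>p v\<close>, so \<open>a\<close>
  extends to an additive function on the whole space, whose continuity at \<open>0\<close> is that of \<open>a\<close> at
  \<open>\<alpha>0\<close>.\<close>

lemma additive_on_orthant_imp_linear:
  fixes a :: "real ^ 'n \<Rightarrow> real"
  assumes add: "\<And>\<alpha> \<beta>. \<alpha> \<in> orthant \<Longrightarrow> \<beta> \<in> orthant \<Longrightarrow> a (\<alpha> + \<beta>) = a \<alpha> + a \<beta>"
    and \<alpha>0: "\<alpha>0 \<in> orthant" and cont: "continuous (at \<alpha>0 within orthant) a"
  obtains A where "linear A" "\<And>\<alpha>. \<alpha> \<in> orthant \<Longrightarrow> a \<alpha> = A \<alpha>"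
proof -
  \<comment> \<open>Every coordinate of \<open>v\<close> is bounded by \<open>norm v\<close> in
    absolute value; the added 1 makes all coordinates of \<open>p v\<close> and
    \<open>v + p v\<close> strictly positive.\<close>
  define p :: "real ^ 'n \<Rightarrow> real ^ 'n" where "p v = vec (norm v + 1)" for v
  define A where "A v = a (v + p v) - a (p v)" for v
  have p: "p v \<in> orthant" for v
    by (simp add: p_def vec_in_orthant add_nonneg_pos)
  have vp: "v + p v \<in> orthant" for v
  proof -
    have "0 < v $ i + (norm v + 1)" for i
      using component_le_norm_cart[of v i] by linarith
    then show ?thesis by (simp add: orthant_def p_def)
  qed
  \<comment> \<open>The extension does not depend on how a vector is written as a difference of
    orthant vectors: the cross sums of two such decompositions coincide.\<close>
  have A_diff: "A (u - w) = a u - a w" if "u \<in> orthant" "w \<in> orthant" for u w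
  proof -
    have "a (((u - w) + p (u - w)) + w) = a (u + p (u - w))" by simp
    then have "a ((u - w) + p (u - w)) + a w = a u + a (p (u - w))"
      using that by (simp only: add vp p)
    then show ?thesis by (simp add: A_def)
  qed
  have A_add: "A (u + v) = A u + A v" for u v
  proof -
    have "u + v = ((u + p u) + (v + p v)) - (p u + p v)" by simp
    then have "A (u + v) = a ((u + p u) + (v + p v)) - a (p u + p v)"
      by (metis A_diff orthant_add p vp)
    then show ?thesis by (simp add: add p vp A_def)
  qed
  have "isCont A 0"
  proof -
    have "isCont a \<alpha>0"
      using cont \<alpha>0 at_within_open[OF _ open_orthant] by metis
    then have lim: "(\<lambda>h. a (\<alpha>0 + h) - a \<alpha>0) \<midarrow>0\<rightarrow> 0"
      by (simp add: isCont_iff LIM_zero)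
    have "((\<lambda>h. \<alpha>0 + h) \<longlongrightarrow> \<alpha>0 + 0) (at 0)" by (intro tendsto_intros)
    then have "\<forall>\<^sub>F h in at 0. \<alpha>0 + h \<in> orthant"
      using topological_tendstoD[OF _ open_orthant] \<alpha>0 by fastforce
    then have "\<forall>\<^sub>F h in at 0. a (\<alpha>0 + h) - a \<alpha>0 = A h"
      by eventually_elim (use A_diff[OF _ \<alpha>0] in fastforce)
    with lim have "A \<midarrow>0\<rightarrow> 0" by (rule Lim_transform_eventually)
    moreover have "A 0 = 0" using A_add[of 0 0] by simp
    ultimately show ?thesis by (simp add: isCont_def)
  qed
  then have "linear A" using A_add by (rule additive_continuous_imp_linear[rotated])
  \<comment> \<open>Here \<open>\<alpha>\<close> is written as
    \<open>(\<alpha> + \<alpha>) - \<alpha>\<close>.\<close>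
  moreover have "a \<alpha> = A \<alpha>" if "\<alpha> \<in> orthant" for \<alpha>
    using A_diff[OF orthant_add[OF that that] that] add[OF that that]
    by (simp only: add_diff_cancel)
  ultimately show ?thesis by (rule that)
qed

section \<open>The Laplace transform of the Riemann-Liouville kernel\<close>

text \<open>This is Euler's integral for \<open>Gamma a\<close> after the substitution by
  \<open>x * u\<close>. It is stated for nonnegative integrals so that integrability in several
  variables follows from the finite value.\<close>

lemma nn_integral_gamma_density:
  fixes a x :: real
  assumes "a > 0" "x > 0"
  shows "(\<integral>\<^sup>+u. ennreal (indicator {0<..} u * (u powr (a - 1) / Gamma a * exp (- (u * x)))) \<partial>lborel) =
    ennreal (x powr - a)"
proof -
  have G: "Gamma a > 0" using assms by simp
  have [measurable]: "(\<lambda>t. indicator {0..} t * t powr (a - 1) / exp t) \<in> borel_measurable (borel :: real measure)"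
    by measurable
  have "ennreal (x powr - a) = ennreal (x powr - a / Gamma a) * ennreal (Gamma a)"
    using G by (simp flip: ennreal_mult)
  also have "ennreal (Gamma a) =
      ennreal x * (\<integral>\<^sup>+u. ennreal (indicator {0..} (x * u) * (x * u) powr (a - 1) / exp (x * u)) \<partial>lborel)"
    unfolding Gamma_conv_nn_integral_real[OF assms(1)]
    by (subst nn_integral_real_affine[where c = x and t = 0]) (use assms in auto)
  also have "ennreal (x powr - a / Gamma a) * \<dots> =
      (\<integral>\<^sup>+u. ennreal (x powr - a / Gamma a * (x * (indicator {0..} (x * u) * (x * u) powr (a - 1) / exp (x * u)))) \<partial>lborel)"
    using assms G
    by (simp add: nn_integral_cmult[symmetric] ennreal_mult'[symmetric] mult.assoc[symmetric]
        del: times_divide_eq_right)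
  also have "\<dots> = (\<integral>\<^sup>+u. ennreal (indicator {0<..} u * (u powr (a - 1) / Gamma a * exp (- (u * x)))) \<partial>lborel)"
  proof (intro nn_integral_cong arg_cong[where f = ennreal])
    fix u :: real
    \<comment> \<open>The indicators differ at \<open>u = 0\<close>, where the left side vanishes as
      well because \<open>0 powr b\<close> is 0 for every \<open>b\<close>.\<close>
    consider "u < 0" | "u = 0" | "u > 0" by linarith
    then show "x powr - a / Gamma a * (x * (indicator {0..} (x * u) * (x * u) powr (a - 1) / exp (x * u))) =
        indicator {0<..} u * (u powr (a - 1) / Gamma a * exp (- (u * x)))"
    proof cases
      case 3
      have "x powr - a * (x * (x * u) powr (a - 1)) = (x powr - a * x powr 1 * x powr (a - 1)) * u powr (a - 1)"
        using assms 3 by (simp add: powr_mult)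
      also have "x powr - a * x powr 1 * x powr (a - 1) = x powr (- a + 1 + (a - 1))"
        by (simp only: powr_add)
      also have "\<dots> * u powr (a - 1) = u powr (a - 1)"
        using assms by simp
      finally have "x powr - a * (x * (x * u) powr (a - 1)) / Gamma a * exp (- (u * x)) =
         u powr (a - 1) / Gamma a * exp (- (u * x))" by simp
      then show ?thesis
        using 3 assms by (simp add: exp_minus field_simps)
    qed (use assms in \<open>auto simp: mult_less_0_iff indicator_def zero_le_mult_iff\<close>)
  qed
  finally show ?thesis by simp
qed

lemma prod_Basis_cart: "(\<Prod>b\<in>Basis. f b) = (\<Prod>i\<in>UNIV. f (axis i (1 :: real)))"
  for f :: "real ^ 'n \<Rightarrow> 'b :: comm_monoid_mult"
proof -
  have inj: "inj (\<lambda>i. axis i 1 :: real ^ 'n)" by (auto simp: inj_on_def axis_eq_axis)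
  have Basis: "Basis = range (\<lambda>i. axis i 1 :: real ^ 'n)" by (auto simp: Basis_vec_def)
  show ?thesis unfolding Basis by (simp add: prod.reindex[OF inj])
qed

text \<open>The integrand is a product of one-variable gamma integrands, so its nonnegative integral
  factorises; the finite value yields integrability and the transform together.\<close>

lemma
  fixes \<alpha> x :: "real ^ 'n"
  assumes \<alpha>: "\<alpha> \<in> orthant" and x: "x \<in> orthant"
  shows integrable_laplace_riemann_liouville_kernel:
      "integrable lebesgue (laplace_integrand (riemann_liouville_kernel \<alpha>) x)"
    and laplace_riemann_liouville_kernel:
      "laplace (riemann_liouville_kernel \<alpha>) x = (\<Prod>i\<in>UNIV. x $ i powr - (\<alpha> $ i))"
proof -
  define h where "h b u = indicator {0<..} u *
      (u powr (\<alpha> \<bullet> b - 1) / Gamma (\<alpha> \<bullet> b) * exp (- (u * (x \<bullet> b))))" for b u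
  let ?f = "laplace_integrand (riemann_liouville_kernel \<alpha>) x"
  have pos: "0 < \<alpha> \<bullet> b" "0 < x \<bullet> b" if "b \<in> Basis" for b
    using that \<alpha> x by (auto simp: Basis_vec_def orthant_def inner_axis)
  have [measurable]: "h b \<in> borel_measurable borel" for b
    unfolding h_def by measurable
  have h_nonneg: "0 \<le> h b u" if "b \<in> Basis" for b u
    using pos[OF that] by (simp add: h_def)
  have f_eq: "?f s = (\<Prod>b\<in>Basis. h b (s \<bullet> b))" for s
  proof -
    have "indicator orthant s = (\<Prod>i\<in>UNIV. indicator {0<..} (s $ i) :: real)"
      by (auto simp: indicator_def orthant_def)
    moreover have "exp (- (s \<bullet> x)) = (\<Prod>i\<in>UNIV. exp (- (s $ i * x $ i)))"
      by (simp add: inner_vec_def exp_sum sum_negf[symmetric])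
    ultimately show ?thesis
      by (simp add: prod_Basis_cart laplace_integrand_def riemann_liouville_kernel_def h_def
          inner_axis prod.distrib prod_dividef)
  qed
  have "?f \<in> borel_measurable borel"
    unfolding f_eq[abs_def] by measurable
  moreover have "(\<integral>\<^sup>+s. ennreal (?f s) \<partial>lborel) = ennreal (\<Prod>i\<in>UNIV. x $ i powr - (\<alpha> $ i))"
  proof -
    have "(\<integral>\<^sup>+s. ennreal (?f s) \<partial>lborel) = (\<integral>\<^sup>+s. (\<Prod>b\<in>Basis. ennreal (h b (s \<bullet> b))) \<partial>lborel)"
      by (simp add: f_eq prod_ennreal h_nonneg)
    also have "\<dots> = (\<Prod>b\<in>Basis. (\<integral>\<^sup>+u. ennreal (h b u) \<partial>lborel))"
      by (rule nn_integral_lborel_prod) auto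
    also have "\<dots> = (\<Prod>b\<in>Basis. ennreal ((x \<bullet> b) powr - (\<alpha> \<bullet> b)))"
      unfolding h_def by (intro prod.cong refl nn_integral_gamma_density pos)
    also have "\<dots> = ennreal (\<Prod>i\<in>UNIV. x $ i powr - (\<alpha> $ i))"
      by (simp add: prod_ennreal prod_Basis_cart inner_axis)
    finally show ?thesis .
  qed
  moreover have "0 \<le> ?f s" for s
    by (simp add: f_eq prod_nonneg h_nonneg)
  ultimately have "integrable lborel ?f \<and> integral\<^sup>L lborel ?f = (\<Prod>i\<in>UNIV. x $ i powr - (\<alpha> $ i))"
    by (subst nn_integral_eq_integrable[symmetric]) (auto intro: prod_nonneg)
  moreover note \<open>?f \<in> borel_measurable borel\<close>
  ultimately show "integrable lebesgue ?f" "laplace (riemann_liouville_kernel \<alpha>) x = (\<Prod>i\<in>UNIV. x $ i powr - (\<alpha> $ i))"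
    by (simp_all add: laplace_eq_integral integrable_completion integral_completion)
qed

lemma laplace_riemann_liouville_kernel_pos:
  "\<alpha> \<in> orthant \<Longrightarrow> x \<in> orthant \<Longrightarrow> 0 < laplace (riemann_liouville_kernel \<alpha>) x"
  unfolding laplace_riemann_liouville_kernel
  by (intro prod_pos) (simp add: orthant_def less_imp_neq[THEN not_sym])

lemma riemann_liouville_kernel_laplace_transformable:
  "\<alpha> \<in> orthant \<Longrightarrow> riemann_liouville_kernel \<alpha> \<in> laplace_transformable"
  by (simp add: laplace_transformable_iff integrable_laplace_riemann_liouville_kernel)

section \<open>Injectivity of the Laplace transform\<close>

text \<open>The substitution maps the orthant into the compact cube \<open>cbox 0 (vec 1)\<close>,
  where Stone-Weierstrass applies.\<close>

definition exp_neg :: "real ^ 'n \<Rightarrow> real ^ 'n" where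
  "exp_neg s = (\<chi> i. exp (- (s $ i)))"

lemma continuous_exp_neg: "continuous_on UNIV exp_neg"
  unfolding exp_neg_def by (intro continuous_intros)

lemma borel_measurable_exp_neg [measurable]: "exp_neg \<in> borel_measurable borel"
  by (rule borel_measurable_continuous_onI) (rule continuous_exp_neg)

lemma laplace_integrand_shift:
  "laplace_integrand f (x + axis i 1) s = laplace_integrand f x s * exp_neg s $ i"
  by (simp add: laplace_integrand_def exp_neg_def inner_add_right inner_axis mult_exp_exp)

text \<open>Multiplying the integrand by a coordinate of \<open>exp_neg s\<close> shifts \<open>x\<close> by a unit vector. The extra
  factor \<open>g\<close> makes the claim stable under products of polynomials.\<close>

lemma laplace_moment_zero_polynomial:
  fixes f g :: "real ^ 'n \<Rightarrow> real"
  assumes "real_polynomial_function P"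
    and "\<And>x. x \<in> orthant \<Longrightarrow> has_bochner_integral lebesgue (\<lambda>s. laplace_integrand f x s * g s) 0"
    and "x \<in> orthant"
  shows "has_bochner_integral lebesgue (\<lambda>s. laplace_integrand f x s * (g s * P (exp_neg s))) 0"
  using assms
proof (induction P arbitrary: g x rule: real_polynomial_function.induct)
  case (linear P)
  \<comment> \<open>A linear \<open>P\<close> is a combination of the coordinates, so
    \<open>laplace_integrand_shift\<close> applies term by term.\<close>
  have P: "P y = (\<Sum>i\<in>UNIV. y $ i * P (axis i 1))" for y
  proof -
    interpret bounded_linear P by fact
    have "P y = P (\<Sum>i\<in>UNIV. y $ i *\<^sub>R axis i 1)"
      by (simp flip: scalar_mult_eq_scaleR add: basis_expansion)
    then show ?thesis by (simp add: sum scaleR)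
  qed
  have eq: "(\<lambda>s. laplace_integrand f x s * (g s * P (exp_neg s))) =
      (\<lambda>s. \<Sum>i\<in>UNIV. laplace_integrand f (x + axis i 1) s * g s * P (axis i 1))"
    by (subst P) (simp add: laplace_integrand_shift sum_distrib_left mult_ac)
  have "x + axis i 1 \<in> orthant" for i
    using linear.prems(2) by (auto simp: orthant_def axis_def add_pos_nonneg)
  from has_bochner_integral_mult_left[OF linear.prems(1)[OF this]]
  have "has_bochner_integral lebesgue (\<lambda>s. \<Sum>i\<in>UNIV. laplace_integrand f (x + axis i 1) s * g s * P (axis i 1))
      (\<Sum>i\<in>(UNIV :: 'n set). 0 * P (axis i 1))"
    by (intro has_bochner_integral_sum) auto
  then show ?case by (simp add: eq)
next
  case (const c)
  from has_bochner_integral_mult_left[OF const.prems(1)[OF const.prems(2)], of c]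
  show ?case by (simp add: mult_ac)
next
  case (add P Q)
  from has_bochner_integral_add[OF add.IH(1)[OF add.prems] add.IH(2)[OF add.prems]]
  show ?case by (simp add: algebra_simps)
next
  case (mult P Q)
  \<comment> \<open>The induction hypothesis for \<open>P\<close>, at all \<open>x\<close>, allows
    \<open>g s * P (exp_neg s)\<close> to take the role of \<open>g\<close> in the one for
    \<open>Q\<close>.\<close>
  from mult.IH(2)[OF mult.IH(1)[OF mult.prems(1)] mult.prems(2)]
  show ?case by (simp add: algebra_simps)
qed

section \<open>Functions whose Laplace transform vanishes\<close>

context
  fixes f h :: "real ^ 'n \<Rightarrow> real"
  assumes f: "f \<in> laplace_transformable"
    and zero: "\<And>x. x \<in> orthant \<Longrightarrow> laplace f x = 0"
  \<comment> \<open>The exponential is positive, so \<open>h\<close> and \<open>f\<close> have the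
    same zeros in the orthant, but \<open>h\<close> is integrable.\<close>
  defines "h \<equiv> laplace_integrand f (vec 1)"
begin

lemma vanishing_laplace_integrable: "integrable lebesgue h"
  using f by (simp add: h_def laplace_transformable_iff orthant_def)

lemma vanishing_laplace_integrable_mult:
  assumes [measurable]: "\<phi> \<in> borel_measurable borel" and bd: "\<And>y. \<bar>\<phi> y\<bar> \<le> B"
  shows "integrable lebesgue (\<lambda>s. h s * \<phi> (exp_neg s))"
proof (rule Bochner_Integration.integrable_bound)
  show "integrable lebesgue (\<lambda>s. B * h s)"
    using vanishing_laplace_integrable by simp
  have "(\<lambda>s. \<phi> (exp_neg s)) \<in> borel_measurable lebesgue"
    by (intro measurable_completion) measurable
  then show "(\<lambda>s. h s * \<phi> (exp_neg s)) \<in> borel_measurable lebesgue"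
    using vanishing_laplace_integrable by (intro borel_measurable_times) auto
  have "\<bar>\<phi> y\<bar> \<le> \<bar>B\<bar>" for y using bd[of y] by linarith
  then show "AE s in lebesgue. norm (h s * \<phi> (exp_neg s)) \<le> norm (B * h s)"
    by (auto simp: abs_mult mult.commute[of "\<bar>B\<bar>"] intro!: AE_I2 mult_left_mono)
qed

text \<open>Polynomials in \<open>exp_neg s\<close> integrate to 0 against \<open>h\<close>.
  Approximating \<open>\<phi>\<close> by one within \<open>e\<close> on the cube changes the
  integral by at most \<open>e\<close> times the integral of \<open>\<bar>h s\<bar>\<close>.\<close>

lemma vanishing_laplace_continuous:
  assumes cont: "continuous_on UNIV \<phi>" and bd: "\<And>y. \<bar>\<phi> y\<bar> \<le> B"
  shows "(\<integral>s. h s * \<phi> (exp_neg s) \<partial>lebesgue) = 0"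
proof -
  let ?I = "\<integral>s. \<bar>h s\<bar> \<partial>lebesgue"
  have meas: "\<phi> \<in> borel_measurable borel" using cont by (rule borel_measurable_continuous_onI)
  have bound: "\<bar>\<integral>s. h s * \<phi> (exp_neg s) \<partial>lebesgue\<bar> \<le> e * ?I" if "e > 0" for e
  proof -
    obtain P where P: "real_polynomial_function P"
      "\<And>y. y \<in> cbox 0 (vec 1) \<Longrightarrow> \<bar>\<phi> y - P y\<bar> < e"
      using Stone_Weierstrass_real_polynomial_function[OF compact_cbox continuous_on_subset[OF cont subset_UNIV] \<open>e > 0\<close>]
      by blast
    have "has_bochner_integral lebesgue (\<lambda>s. laplace_integrand f (vec 1) s * (1 * P (exp_neg s))) 0"
    proof (rule laplace_moment_zero_polynomial[OF P(1)])
      show "has_bochner_integral lebesgue (\<lambda>s. laplace_integrand f x s * 1) 0" if "x \<in> orthant" for x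
        using that f zero[OF that]
        by (simp add: has_bochner_integral_iff laplace_transformable_iff laplace_eq_integral)
    qed (simp add: orthant_def)
    then have hP: "integrable lebesgue (\<lambda>s. h s * P (exp_neg s))" "(\<integral>s. h s * P (exp_neg s) \<partial>lebesgue) = 0"
      by (simp_all add: has_bochner_integral_iff h_def)
    have "(\<integral>s. h s * \<phi> (exp_neg s) \<partial>lebesgue) =
        (\<integral>s. h s * \<phi> (exp_neg s) - h s * P (exp_neg s) \<partial>lebesgue)"
      using hP vanishing_laplace_integrable_mult[OF meas bd] by simp
    also have "\<bar>\<dots>\<bar> \<le> (\<integral>s. e * \<bar>h s\<bar> \<partial>lebesgue)"
    proof (rule integral_abs_bound_integral)
      show "integrable lebesgue (\<lambda>s. h s * \<phi> (exp_neg s) - h s * P (exp_neg s))"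
        using hP(1) vanishing_laplace_integrable_mult[OF meas bd] by (rule Bochner_Integration.integrable_diff[rotated])
      show "integrable lebesgue (\<lambda>s. e * \<bar>h s\<bar>)"
        using vanishing_laplace_integrable by simp
      fix s
      show "\<bar>h s * \<phi> (exp_neg s) - h s * P (exp_neg s)\<bar> \<le> e * \<bar>h s\<bar>"
      \<comment> \<open>Outside the orthant \<open>h\<close> vanishes, so approximation on the cube
        suffices.\<close>
      proof (cases "s \<in> orthant")
        case True
        then have "exp_neg s \<in> cbox 0 (vec 1)"
          by (auto simp: mem_box_cart exp_neg_def orthant_def less_imp_le)
        from P(2)[OF this] have "\<bar>h s\<bar> * \<bar>\<phi> (exp_neg s) - P (exp_neg s)\<bar> \<le> \<bar>h s\<bar> * e"
          by (intro mult_left_mono) auto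
        then show ?thesis by (simp add: abs_mult[symmetric] algebra_simps)
      qed (simp add: h_def laplace_integrand_def)
    qed
    finally show ?thesis by simp
  qed
  have I: "0 \<le> ?I" by simp
  show ?thesis
  proof (rule ccontr)
    assume "(\<integral>s. h s * \<phi> (exp_neg s) \<partial>lebesgue) \<noteq> 0"
    then have pos: "0 < \<bar>\<integral>s. h s * \<phi> (exp_neg s) \<partial>lebesgue\<bar>" (is "0 < ?J") by simp
    \<comment> \<open>This choice of \<open>e\<close> makes the bound smaller than
      \<open>?J\<close>; the added 1 covers \<open>?I = 0\<close>.\<close>
    have "?J \<le> ?J / (2 * (?I + 1)) * ?I" using bound[of "?J / (2 * (?I + 1))"] pos I by simp
    also have "\<dots> < ?J" using pos I by (simp add: field_simps add_pos_nonneg)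
    finally show False by simp
  qed
qed

text \<open>The indicator of a closed set is a pointwise limit of bounded continuous functions;
  dominated convergence with majorant \<open>\<bar>h s\<bar>\<close> passes to the limit.\<close>

lemma vanishing_laplace_closed:
  assumes "closed B"
  shows "(\<integral>s. h s * indicator B (exp_neg s) \<partial>lebesgue) = 0"
\<comment> \<open>The empty set is separate because \<open>infdist y {}\<close> is 0, which would
  make the functions below constantly 1.\<close>
proof (cases "B = {}")
  case False
  \<comment> \<open>Equal to 1 on \<open>B\<close>, and to 0 at distance at least
    \<open>1 / k\<close> from it when \<open>k > 0\<close>.\<close>
  define \<phi> where "\<phi> k y = max 0 (1 - of_nat k * infdist y B)" for k y
  have cont: "continuous_on UNIV (\<phi> k)" for k
    unfolding \<phi>_def by (intro continuous_intros)
  have bd: "\<bar>\<phi> k y\<bar> \<le> 1" for k y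
    by (simp add: \<phi>_def infdist_nonneg)
  have lim: "(\<lambda>k. \<phi> k y) \<longlonglongrightarrow> indicator B y" for y
  proof (cases "y \<in> B")
    case True
    then show ?thesis by (simp add: \<phi>_def)
  next
    case y: False
    then have d: "infdist y B > 0" using infdist_pos_not_in_closed[OF assms False] by simp
    have "\<forall>\<^sub>F k in sequentially. 1 / infdist y B \<le> of_nat k"
      by (rule eventually_at_top_linorderI[where c = "nat \<lceil>1 / infdist y B\<rceil>"]) linarith
    then have "\<forall>\<^sub>F k in sequentially. \<phi> k y = indicator B y"
      by eventually_elim (use d y in \<open>simp add: \<phi>_def field_simps\<close>)
    then show ?thesis by (rule tendsto_eventually)
  qed
  have m: "(\<lambda>s. h s * u (exp_neg s)) \<in> borel_measurable lebesgue"
    if "u \<in> borel_measurable borel" for u :: "real ^ 'n \<Rightarrow> real"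
  proof -
    note that [measurable]
    have "(\<lambda>s. u (exp_neg s)) \<in> borel_measurable lebesgue"
      by (intro measurable_completion) measurable
    then show ?thesis using vanishing_laplace_integrable by (intro borel_measurable_times) auto
  qed
  have "(\<lambda>k. \<integral>s. h s * \<phi> k (exp_neg s) \<partial>lebesgue) \<longlonglongrightarrow> (\<integral>s. h s * indicator B (exp_neg s) \<partial>lebesgue)"
  proof (rule integral_dominated_convergence[where w = "\<lambda>s. \<bar>h s\<bar>"])
    show "(\<lambda>s. h s * indicator B (exp_neg s)) \<in> borel_measurable lebesgue"
      using assms by (intro m) (auto intro: borel_closed)
    show "(\<lambda>s. h s * \<phi> k (exp_neg s)) \<in> borel_measurable lebesgue" for k
      by (intro m borel_measurable_continuous_onI cont)
    show "AE s in lebesgue. norm (h s * \<phi> k (exp_neg s)) \<le> \<bar>h s\<bar>" for k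
      using bd by (auto simp: abs_mult mult_left_le)
    show "AE s in lebesgue. (\<lambda>k. h s * \<phi> k (exp_neg s)) \<longlonglongrightarrow> h s * indicator B (exp_neg s)"
      by (intro AE_I2 tendsto_mult_left lim)
  qed (use vanishing_laplace_integrable in simp)
  then show ?thesis
    unfolding vanishing_laplace_continuous[OF cont bd] by (simp add: LIMSEQ_const_iff)
qed simp

text \<open>Closed sets are stable under intersection and generate the Borel sets, so Dynkin's
  theorem extends the claim from them.\<close>

lemma vanishing_laplace_borel:
  assumes "B \<in> sets borel"
  shows "(LINT s:exp_neg -` B|lebesgue. h s) = 0"
proof -
  have closed: "(LINT s:exp_neg -` B|lebesgue. h s) = 0" if "closed B" for B
    using vanishing_laplace_closed[OF that]
    by (simp add: set_lebesgue_integral_def indicator_vimage mult.commute)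
  have sets: "exp_neg -` B \<in> sets lebesgue" if "B \<in> sets borel" for B :: "(real ^ 'n) set"
    using measurable_sets[OF borel_measurable_exp_neg that] by (auto intro: sets_completionI_sets)
  have int: "set_integrable lebesgue (exp_neg -` B) h" if "B \<in> sets borel" for B
    unfolding set_integrable_def
    using vanishing_laplace_integrable sets[OF that] by (rule integrable_mult_indicator[rotated])
  have borel: "sigma_sets UNIV (Collect closed) = sets (borel :: (real ^ 'n) measure)"
    by (simp add: borel_eq_closed)
  have "Int_stable (Collect closed)" "Collect closed \<subseteq> Pow (UNIV :: (real ^ 'n) set)"
    "B \<in> sigma_sets UNIV (Collect closed)"
    using assms borel by (auto simp: Int_stable_def)
  then show ?thesis
  proof (induction rule: sigma_sets_induct_disjoint)
    case (compl B)
    then have B: "B \<in> sets borel" using borel by simp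
    \<comment> \<open>The total integral is 0 because \<open>UNIV\<close> is closed.\<close>
    have "(LINT s:exp_neg -` UNIV|lebesgue. h s) =
        (LINT s:exp_neg -` B|lebesgue. h s) + (LINT s:exp_neg -` (UNIV - B)|lebesgue. h s)"
      by (subst set_integral_Un[symmetric]) (use int[OF B] int[of "UNIV - B"] B in \<open>auto simp: vimage_Un[symmetric] vimage_Int[symmetric]\<close>)
    then show ?case using compl.IH closed[of UNIV] by simp
  next
    case (union B)
    then have B: "B i \<in> sets borel" for i using borel by auto
    have "(LINT s:(\<Union>i. exp_neg -` B i)|lebesgue. h s) = (\<Sum>i. (LINT s:exp_neg -` B i|lebesgue. h s))"
    proof (rule lebesgue_integral_countable_add)
      show "set_integrable lebesgue (\<Union>i. exp_neg -` B i) h"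
        using int[of "\<Union>i. B i"] B by (simp add: vimage_UN)
      show "exp_neg -` B i \<inter> exp_neg -` B j = {}" if "i \<noteq> j" for i j
        using union.hyps(1) that by (auto simp: disjoint_family_on_def)
    qed (rule sets[OF B])
    then show ?case using union.IH by (simp add: vimage_UN)
  qed (simp_all add: closed closed[OF closed_empty, simplified])
qed

text \<open>As \<open>exp_neg\<close> has a Borel left inverse, every Borel set is a preimage under
  \<open>exp_neg\<close>. So \<open>h\<close> integrates to 0 over all Borel sets and vanishes
  almost everywhere.\<close>

lemma vanishing_laplace_AE: "AE t\<in>orthant in lebesgue. f t = 0"
proof -
  obtain h' where h': "integrable lborel h'" "AE s in lborel. h s = h' s"
    using vanishing_laplace_integrable by (rule integrable_lebesgue_borel_version)
  have [measurable]: "h' \<in> borel_measurable borel" using h'(1) by auto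
  define l :: "real ^ 'n \<Rightarrow> real ^ 'n" where "l y = (\<chi> i. - ln (y $ i))" for y
  have [measurable]: "l \<in> borel_measurable borel"
    unfolding borel_measurable_euclidean_space[of l]
    by (auto simp: Basis_vec_def inner_axis l_def)
  have inv: "l (exp_neg s) = s" for s
    by (simp add: l_def exp_neg_def vec_eq_iff)
  \<comment> \<open>The Borel version \<open>h'\<close> is compared with the density 0 through
    integrals over Borel sets.\<close>
  have "AE s in lborel. h' s = 0"
  proof (rule density_unique_real)
    fix A :: "(real ^ 'n) set" assume "A \<in> sets lborel"
    then have A [measurable]: "A \<in> sets borel" by simp
    have "AE s in lborel. indicator A s * h s = indicator A s * h' s"
      using h'(2) by eventually_elim simp
    then have "(LINT s:A|lebesgue. h s) = (\<integral>s. indicator A s * h' s \<partial>lebesgue)"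
      unfolding set_lebesgue_integral_def real_scaleR_def by (rule integral_lebesgue_cong_AE)
    also have "\<dots> = (LINT s:A|lborel. h' s)"
      unfolding set_lebesgue_integral_def real_scaleR_def by (rule integral_completion) measurable
    finally have "(LINT s:A|lborel. h' s) = (LINT s:A|lebesgue. h s)" ..
    moreover have "A = exp_neg -` (l -` A)" by (auto simp: inv)
    moreover have "(LINT s:exp_neg -` (l -` A)|lebesgue. h s) = 0"
      using measurable_sets[of l borel borel A] by (intro vanishing_laplace_borel) simp
    ultimately show "(LINT s:A|lborel. h' s) = (LINT s:A|lborel. 0)" by simp
  qed (use h' in auto)
  with h'(2) have "AE s in lborel. s \<in> orthant \<longrightarrow> f s = 0"
    by eventually_elim (auto simp: h_def laplace_integrand_def)
  then show ?thesis by (rule AE_completion)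
qed

end

lemma laplace_transformable_diff:
  "f \<in> laplace_transformable \<Longrightarrow> g \<in> laplace_transformable \<Longrightarrow> (\<lambda>s. f s - g s) \<in> laplace_transformable"
  and laplace_diff:
  "f \<in> laplace_transformable \<Longrightarrow> g \<in> laplace_transformable \<Longrightarrow> x \<in> orthant \<Longrightarrow>
    laplace (\<lambda>s. f s - g s) x = laplace f x - laplace g x"
proof -
  have "laplace_integrand (\<lambda>s. f s - g s) x = (\<lambda>s. laplace_integrand f x s - laplace_integrand g x s)" for x
    by (auto simp: laplace_integrand_def algebra_simps)
  then show
  "f \<in> laplace_transformable \<Longrightarrow> g \<in> laplace_transformable \<Longrightarrow> (\<lambda>s. f s - g s) \<in> laplace_transformable"
  "f \<in> laplace_transformable \<Longrightarrow> g \<in> laplace_transformable \<Longrightarrow> x \<in> orthant \<Longrightarrow>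
    laplace (\<lambda>s. f s - g s) x = laplace f x - laplace g x"
    by (simp_all add: laplace_transformable_iff laplace_eq_integral)
qed

lemma laplace_inj:
  assumes "f \<in> laplace_transformable" "g \<in> laplace_transformable"
    and "\<And>x. x \<in> orthant \<Longrightarrow> laplace f x = laplace g x"
  shows "AE t\<in>orthant in lebesgue. f t = g t"
  using vanishing_laplace_AE[of "\<lambda>s. f s - g s"] assms
  by (simp add: laplace_transformable_diff laplace_diff)

section \<open>Identification of the kernels\<close>

text \<open>This makes the filter in \<open>identity_condition\<close> nontrivial, so that its
  limits are unique. In dimension 1 the set would be just the point \<open>axis i 1\<close>.\<close>

lemma axis_islimpt_orthant_face:
  assumes "CARD('n) > 1"
  shows "(axis i 1 :: real ^ 'n) islimpt {\<alpha>\<in>orthant. \<alpha> $ i = 1}"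
  unfolding islimpt_sequential
proof (intro exI conjI allI)
  \<comment> \<open>Points on the segment from \<open>axis i 1\<close> to \<open>vec 1\<close>:
    coordinate \<open>i\<close> stays 1, the others equal \<open>inverse (Suc k)\<close>.\<close>
  let ?p = "\<lambda>k :: nat. axis i 1 + inverse (real (Suc k)) *\<^sub>R (vec 1 - axis i 1) :: real ^ 'n"
  have "UNIV \<noteq> {i}" using assms by (metis card_1_singleton_iff less_irrefl One_nat_def)
  then obtain j where j: "j \<noteq> i" by auto
  show "?p k \<in> {\<alpha>\<in>orthant. \<alpha> $ i = 1} - {axis i 1}" for k
  proof -
    have "?p k $ j \<noteq> (axis i 1 :: real ^ 'n) $ j" using j by (simp add: axis_def)
    then have "?p k \<noteq> axis i 1" by metis
    then show ?thesis by (auto simp: orthant_def axis_def)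
  qed
  have "?p \<longlonglongrightarrow> axis i 1 + 0 *\<^sub>R (vec 1 - axis i 1)"
    by (intro tendsto_intros LIMSEQ_inverse_real_of_nat)
  then show "?p \<longlonglongrightarrow> axis i 1" by simp
qed

text \<open>To be applied at a fixed \<open>x\<close> with \<open>c i = 1 / x $ i\<close>. The
  limits serve twice: they exclude the zero function, and they fix the linear extension of the
  logarithm of \<open>\<phi>\<close> on the unit vectors.\<close>

lemma multiplicative_on_orthant:
  fixes \<phi> :: "real ^ 'n \<Rightarrow> real"
  assumes dim: "CARD('n) > 1"
    and mult: "\<And>\<alpha> \<beta>. \<alpha> \<in> orthant \<Longrightarrow> \<beta> \<in> orthant \<Longrightarrow> \<phi> (\<alpha> + \<beta>) = \<phi> \<alpha> * \<phi> \<beta>"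
    and \<alpha>0: "\<alpha>0 \<in> orthant" and cont: "continuous (at \<alpha>0 within orthant) \<phi>"
    and lim: "\<And>i. (\<phi> \<longlongrightarrow> c i) (at (axis i 1) within {\<alpha>\<in>orthant. \<alpha> $ i = 1})"
    and c: "\<And>i. c i \<noteq> 0"
    and \<alpha>: "\<alpha> \<in> orthant"
  shows "\<phi> \<alpha> = (\<Prod>i\<in>UNIV. c i powr (\<alpha> $ i))"
proof -
  let ?F = "\<lambda>i. at (axis i 1) within {\<alpha>\<in>orthant. \<alpha> $ i = 1} :: (real ^ 'n) filter"
  have nontriv: "?F i \<noteq> bot" for i
    using axis_islimpt_orthant_face[OF dim, of i] trivial_limit_within by blast
  have in_face: "\<forall>\<^sub>F \<alpha> in ?F i. \<alpha> \<in> orthant" for i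
    by (auto simp: eventually_at_filter)
  \<comment> \<open>Each value is a square, hence nonnegative; the same identity moves a zero
    towards the origin.\<close>
  have half: "\<phi> \<beta> = \<phi> ((1/2) *\<^sub>R \<beta>) ^ 2" if "\<beta> \<in> orthant" for \<beta>
  proof -
    have "(1/2) *\<^sub>R \<beta> + (1/2) *\<^sub>R \<beta> = \<beta>" by (simp flip: scaleR_add_left)
    then show ?thesis
      using mult[of "(1/2) *\<^sub>R \<beta>" "(1/2) *\<^sub>R \<beta>"] orthant_scaleR[OF that, of "1/2"]
      by (simp add: power2_eq_square)
  qed
  have nonzero: "\<phi> \<beta> \<noteq> 0" if \<beta>: "\<beta> \<in> orthant" for \<beta>
  proof
    assume "\<phi> \<beta> = 0"
    then have small: "\<phi> ((1/2) ^ k *\<^sub>R \<beta>) = 0" for k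
    proof (induction k)
      case (Suc k)
      then show ?case using half[OF orthant_scaleR[OF \<beta>, of "(1/2) ^ k"]] by simp
    qed simp
    \<comment> \<open>The orthant is open, so a small multiple of \<open>\<beta>\<close> at which
      \<open>\<phi>\<close> vanishes can be split off any \<open>\<gamma>\<close>.\<close>
    have zero: "\<phi> \<gamma> = 0" if "\<gamma> \<in> orthant" for \<gamma>
    proof -
      have "(\<lambda>k. \<gamma> - (1/2) ^ k *\<^sub>R \<beta>) \<longlonglongrightarrow> \<gamma> - 0 *\<^sub>R \<beta>"
        by (intro tendsto_intros LIMSEQ_power_zero) simp
      then have "\<forall>\<^sub>F k in sequentially. \<gamma> - (1/2) ^ k *\<^sub>R \<beta> \<in> orthant"
        using topological_tendstoD[OF _ open_orthant] that by fastforce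
      then obtain k where "\<gamma> - (1/2) ^ k *\<^sub>R \<beta> \<in> orthant"
        by (auto simp: eventually_sequentially)
      from mult[OF this orthant_scaleR[OF \<beta>, of "(1/2) ^ k"]] small[of k]
      show ?thesis by simp
    qed
    fix i
    have "(\<phi> \<longlongrightarrow> 0) (?F i)"
      by (rule tendsto_eventually) (use in_face in \<open>eventually_elim, simp add: zero\<close>)
    then show False using tendsto_unique[OF nontriv lim] c by blast
  qed
  have pos: "0 < \<phi> \<beta>" if "\<beta> \<in> orthant" for \<beta>
    using half[OF that] nonzero[OF that] by (metis zero_le_power2 less_le)
  obtain A where A: "linear A" "\<And>\<beta>. \<beta> \<in> orthant \<Longrightarrow> ln (\<phi> \<beta>) = A \<beta>"
  proof (rule additive_on_orthant_imp_linear[of "\<lambda>\<beta>. ln (\<phi> \<beta>)"])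
    show "ln (\<phi> (\<alpha> + \<beta>)) = ln (\<phi> \<alpha>) + ln (\<phi> \<beta>)" if "\<alpha> \<in> orthant" "\<beta> \<in> orthant" for \<alpha> \<beta>
      using pos that by (simp add: mult ln_mult_pos)
    show "continuous (at \<alpha>0 within orthant) (\<lambda>\<beta>. ln (\<phi> \<beta>))"
      using cont pos[OF \<alpha>0] unfolding continuous_within by (intro tendsto_ln) auto
  qed (use \<alpha>0 in auto)
  have \<phi>_eq: "\<phi> \<beta> = exp (A \<beta>)" if "\<beta> \<in> orthant" for \<beta>
    using A(2)[OF that] pos[OF that] by (metis exp_ln)
  \<comment> \<open>The unit vector lies outside the orthant, so the limit is computed from the
    continuity of the extension \<open>A\<close>.\<close>
  have c_eq: "c i = exp (A (axis i 1))" for i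
  proof (rule tendsto_unique[OF nontriv lim])
    have "bounded_linear A" using A(1) by (simp add: linear_conv_bounded_linear)
    then have "((\<lambda>\<beta>. exp (A \<beta>)) \<longlongrightarrow> exp (A (axis i 1))) (?F i)"
      using tendsto_ident_at by (intro tendsto_exp) (rule bounded_linear.tendsto)
    moreover have "\<forall>\<^sub>F \<beta> in ?F i. exp (A \<beta>) = \<phi> \<beta>"
      using in_face by eventually_elim (simp add: \<phi>_eq)
    ultimately show "(\<phi> \<longlongrightarrow> exp (A (axis i 1))) (?F i)"
      by (rule Lim_transform_eventually)
  qed
  have "A \<alpha> = A (\<Sum>i\<in>UNIV. \<alpha> $ i *\<^sub>R axis i 1)"
    by (simp flip: scalar_mult_eq_scaleR add: basis_expansion)
  also have "\<dots> = (\<Sum>i\<in>UNIV. \<alpha> $ i * A (axis i 1))"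
    by (simp add: linear_sum[OF A(1)] linear_cmul[OF A(1)])
  finally show ?thesis
    by (simp add: \<phi>_eq[OF \<alpha>] exp_sum c_eq powr_def)
qed

section \<open>Equivalence of the two continuity conditions\<close>

lemma continuous_within_cong:
  assumes "a \<in> S" and "\<And>x. x \<in> S \<Longrightarrow> f x = g x"
  shows "continuous (at a within S) f \<longleftrightarrow> continuous (at a within S) g"
  unfolding continuous_within assms(2)[OF assms(1)]
  by (intro Lim_cong_within refl) (use assms(2) in auto)

text \<open>The transform of the operator is \<open>laplace (K \<alpha>) x * laplace f x\<close>,
  with a second factor independent of \<open>\<alpha>\<close>. The converse divides by that factor
  for one test function.\<close>

lemma kernel_continuity_iff_operator_continuity:
  fixes K :: "real ^ 'n \<Rightarrow> real ^ 'n \<Rightarrow> real"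
  assumes "\<And>\<alpha>. \<alpha> \<in> orthant \<Longrightarrow> K \<alpha> \<in> laplace_transformable"
  shows "kernel_continuity K \<longleftrightarrow> operator_continuity (\<lambda>\<alpha>. convolution (K \<alpha>))"
proof -
  have cong: "continuous (at \<alpha>0 within orthant) (\<lambda>\<alpha>. laplace (convolution (K \<alpha>) f) x) \<longleftrightarrow>
      continuous (at \<alpha>0 within orthant) (\<lambda>\<alpha>. laplace (K \<alpha>) x * laplace f x)"
    if "f \<in> laplace_transformable" "x \<in> orthant" "\<alpha>0 \<in> orthant" for f x \<alpha>0
    using that assms by (intro continuous_within_cong) (auto simp: laplace_convolution)
  show ?thesis
  proof
    assume ker: "kernel_continuity K"
    show "operator_continuity (\<lambda>\<alpha>. convolution (K \<alpha>))"
      unfolding operator_continuity_def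
    proof (intro ballI)
      fix f :: "real ^ 'n \<Rightarrow> real" and x :: "real ^ 'n"
      assume f: "f \<in> laplace_transformable" and x: "x \<in> orthant"
      obtain \<alpha>0 where \<alpha>0: "\<alpha>0 \<in> orthant" "continuous (at \<alpha>0 within orthant) (\<lambda>\<alpha>. laplace (K \<alpha>) x)"
        using ker x by (auto simp: kernel_continuity_def)
      show "\<exists>\<alpha>0\<in>orthant. continuous (at \<alpha>0 within orthant) (\<lambda>\<alpha>. laplace (convolution (K \<alpha>) f) x)"
        using continuous_mult[OF \<alpha>0(2) continuous_const] cong[OF f x \<alpha>0(1)] \<alpha>0(1) by blast
    qed
  next
    assume op: "operator_continuity (\<lambda>\<alpha>. convolution (K \<alpha>))"
    show "kernel_continuity K"
      unfolding kernel_continuity_def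
    proof
      fix x :: "real ^ 'n" assume x: "x \<in> orthant"
      \<comment> \<open>This kernel is the constant 1 on the orthant, and its transform is positive
        there.\<close>
      let ?f = "riemann_liouville_kernel (vec 1 :: real ^ 'n)"
      have f: "?f \<in> laplace_transformable"
        by (intro riemann_liouville_kernel_laplace_transformable vec_in_orthant) simp
      have "laplace ?f x \<noteq> 0"
        using laplace_riemann_liouville_kernel_pos[OF vec_in_orthant x, of 1] by simp
      obtain \<alpha>0 where \<alpha>0: "\<alpha>0 \<in> orthant"
        "continuous (at \<alpha>0 within orthant) (\<lambda>\<alpha>. laplace (K \<alpha>) x * laplace ?f x)"
        using op f x cong unfolding operator_continuity_def by blast
      from continuous_mult[OF this(2) continuous_const[of _ "inverse (laplace ?f x)"]]
      have "continuous (at \<alpha>0 within orthant) (\<lambda>\<alpha>. laplace (K \<alpha>) x)"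
        using \<open>laplace ?f x \<noteq> 0\<close> by (simp add: mult.assoc)
      with \<alpha>0 show "\<exists>\<alpha>0\<in>orthant. continuous (at \<alpha>0 within orthant) (\<lambda>\<alpha>. laplace (K \<alpha>) x)"
        by blast
    qed
  qed
qed

text \<open>Transforming the index law for a single test function gives the identity times
  \<open>laplace ?f x\<close>, which is nonzero and cancels.\<close>

lemma laplace_kernel_mult:
  fixes K :: "real ^ 'n \<Rightarrow> real ^ 'n \<Rightarrow> real"
  assumes K: "\<And>\<alpha>. \<alpha> \<in> orthant \<Longrightarrow> K \<alpha> \<in> laplace_transformable"
    and law: "index_law (\<lambda>\<alpha>. convolution (K \<alpha>))"
    and \<alpha>: "\<alpha> \<in> orthant" and \<beta>: "\<beta> \<in> orthant" and x: "x \<in> orthant"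
  shows "laplace (K (\<alpha> + \<beta>)) x = laplace (K \<alpha>) x * laplace (K \<beta>) x"
proof -
  let ?f = "riemann_liouville_kernel (vec 1 :: real ^ 'n)"
  have f: "?f \<in> laplace_transformable"
    by (intro riemann_liouville_kernel_laplace_transformable vec_in_orthant) simp
  have "laplace ?f x \<noteq> 0"
    using laplace_riemann_liouville_kernel_pos[OF vec_in_orthant x, of 1] by simp
  moreover have "laplace (convolution (K (\<alpha> + \<beta>)) ?f) x = laplace (convolution (K \<alpha>) (convolution (K \<beta>) ?f)) x"
    using law \<alpha> \<beta> f by (intro laplace_cong_AE) (simp add: index_law_def)
  then have "laplace (K (\<alpha> + \<beta>)) x * laplace ?f x = laplace (K \<alpha>) x * laplace (K \<beta>) x * laplace ?f x"
    using \<alpha> \<beta> x f K by (simp add: laplace_convolution convolution_laplace_transformable orthant_add)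
  ultimately show ?thesis by simp
qed

theorem theorem5p1:
  fixes K :: "real ^ 'n \<Rightarrow> real ^ 'n \<Rightarrow> real"
    and J :: "real ^ 'n \<Rightarrow> (real ^ 'n \<Rightarrow> real) \<Rightarrow> real ^ 'n \<Rightarrow> real"
  assumes dim: "CARD('n) > 1"
    and kernels: "\<And>\<alpha>. \<alpha> \<in> orthant \<Longrightarrow> K \<alpha> \<in> laplace_transformable"
    and J: "\<And>\<alpha> f. J \<alpha> f = convolution (K \<alpha>) f"
  shows "(kernel_continuity K \<longleftrightarrow> operator_continuity J) \<and>
    (identity_condition K \<longrightarrow> index_law J \<longrightarrow> kernel_continuity K \<longrightarrow>
      (\<forall>\<alpha>\<in>orthant. \<forall>f\<in>laplace_transformable.
         AE t\<in>orthant in lebesgue. J \<alpha> f t = riemann_liouville \<alpha> f t))"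
proof (intro conjI impI ballI)
  have J_eq: "J = (\<lambda>\<alpha>. convolution (K \<alpha>))" by (intro ext) (simp add: J)
  show "kernel_continuity K \<longleftrightarrow> operator_continuity J"
    unfolding J_eq using kernels by (rule kernel_continuity_iff_operator_continuity)
  fix \<alpha> :: "real ^ 'n" and f :: "real ^ 'n \<Rightarrow> real"
  assume ident: "identity_condition K" and law: "index_law J" and cont: "kernel_continuity K"
    and \<alpha>: "\<alpha> \<in> orthant"
  have "laplace (K \<alpha>) x = laplace (riemann_liouville_kernel \<alpha>) x" if x: "x \<in> orthant" for x
  proof -
    have x_pos: "0 < x $ i" for i using x by (simp add: orthant_def)
    \<comment> \<open>The point may depend on \<open>x\<close>, since the functional equation is
      solved for each \<open>x\<close> separately.\<close>
    obtain \<alpha>0 where \<alpha>0: "\<alpha>0 \<in> orthant"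
      "continuous (at \<alpha>0 within orthant) (\<lambda>\<alpha>. laplace (K \<alpha>) x)"
      using cont x by (auto simp: kernel_continuity_def)
    have "laplace (K \<alpha>) x = (\<Prod>i\<in>UNIV. (1 / x $ i) powr (\<alpha> $ i))"
    proof (rule multiplicative_on_orthant[OF dim _ \<alpha>0 _ _ \<alpha>])
      show "laplace (K (\<alpha> + \<beta>)) x = laplace (K \<alpha>) x * laplace (K \<beta>) x"
        if "\<alpha> \<in> orthant" "\<beta> \<in> orthant" for \<alpha> \<beta>
        using kernels law that x by (intro laplace_kernel_mult) (simp_all add: J_eq)
      show "((\<lambda>\<alpha>. laplace (K \<alpha>) x) \<longlongrightarrow> 1 / x $ i) (at (axis i 1) within {\<alpha>\<in>orthant. \<alpha> $ i = 1})" for i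
        using ident x by (simp add: identity_condition_def)
      show "1 / x $ i \<noteq> 0" for i using x_pos[of i] by simp
    qed
    also have "\<dots> = (\<Prod>i\<in>UNIV. x $ i powr - (\<alpha> $ i))"
      using x_pos by (intro prod.cong refl) (simp add: powr_divide powr_minus_divide less_imp_le)
    finally show ?thesis by (simp add: laplace_riemann_liouville_kernel \<alpha> x)
  qed
  then have "AE t\<in>orthant in lebesgue. K \<alpha> t = riemann_liouville_kernel \<alpha> t"
    using kernels \<alpha> by (intro laplace_inj riemann_liouville_kernel_laplace_transformable) auto
  \<comment> \<open>Convolution does not see null sets of the kernel, so the operators agree at
    every \<open>t\<close>.\<close>
  then have "J \<alpha> f t = riemann_liouville \<alpha> f t" for t
    unfolding J riemann_liouville_def by (rule convolution_cong_AE)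
  then show "AE t\<in>orthant in lebesgue. J \<alpha> f t = riemann_liouville \<alpha> f t" by simp
qed

end
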